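(* Let $\mathbb{D}=\{z\in\mathbb{C}:|z|<1\}$ and let $\tau:\mathbb{D}\to\mathbb{D}$ be analytic. Suppose that $\overline{\tau(\mathbb{D})}\subseteq\mathbb{D}$, where $\overline{\tau(\mathbb{D})}$ is the closure of $\tau(\mathbb{D})$. If $\psi\in H^2$, then the weighted composition operator $W_{\psi,\tau}$ is a Hilbert-Schmidt operator on $H^2$.
   Context: $H^2$ is the Hardy space of the unit disc: the Hilbert space of analytic functions $f(z)=\sum_{n\ge0}a_nz^n$ on $\mathbb{D}$ with $\sum_{n\ge 0}|a_n|^2<\infty$, identified via boundary values with the closed subspace of $L^2(\mathbb{T})$ ($\mathbb{T}$ the unit circle) of functions whose Fourier coefficients of negative index vanish, with inner product $\langle f,g\rangle=\frac{1}{2\pi}\int_0^{2\pi}f\overline{g}\,d\theta$. For $\psi$ analytic on $\mathbb{D}$ and $\tau:\mathbb{D}\to\mathbb{D}$ analytic, the weighted composition operator $W_{\psi,\tau}$ is defined by $W_{\psi,\tau}f=\psi\cdot(f\circ\tau)$ for $f\in H^2$. *)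

theory Defs
  imports "HOL-Complex_Analysis.Complex_Analysis"
begin

text \<open>
  Hilbert spaces of complex-valued functions are given by a carrier set and an inner product
  (linear in the first argument), with pointwise vector space operations.
\<close>

definition ip_norm :: "(('a \<Rightarrow> complex) \<Rightarrow> ('a \<Rightarrow> complex) \<Rightarrow> complex) \<Rightarrow> ('a \<Rightarrow> complex) \<Rightarrow> real" where
  "ip_norm ip f = sqrt (Re (ip f f))"

definition bounded_operator_on ::
  "('a \<Rightarrow> complex) set \<Rightarrow> (('a \<Rightarrow> complex) \<Rightarrow> ('a \<Rightarrow> complex) \<Rightarrow> complex) \<Rightarrow>
   (('a \<Rightarrow> complex) \<Rightarrow> ('a \<Rightarrow> complex)) \<Rightarrow> bool" where
  "bounded_operator_on H ip T \<longleftrightarrow>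
     (\<forall>f\<in>H. T f \<in> H) \<and>
     (\<forall>f\<in>H. \<forall>g\<in>H. T (\<lambda>x. f x + g x) = (\<lambda>x. T f x + T g x)) \<and>
     (\<forall>c. \<forall>f\<in>H. T (\<lambda>x. c * f x) = (\<lambda>x. c * T f x)) \<and>
     (\<exists>C. \<forall>f\<in>H. ip_norm ip (T f) \<le> C * ip_norm ip f)"

text \<open>An orthonormal basis is a maximal orthonormal set.\<close>

definition orthonormal_basis_on ::
  "('a \<Rightarrow> complex) set \<Rightarrow> (('a \<Rightarrow> complex) \<Rightarrow> ('a \<Rightarrow> complex) \<Rightarrow> complex) \<Rightarrow>
   ('a \<Rightarrow> complex) set \<Rightarrow> bool" where
  "orthonormal_basis_on H ip B \<longleftrightarrow>
     B \<subseteq> H \<and>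
     (\<forall>e\<in>B. \<forall>e'\<in>B. ip e e' = (if e = e' then 1 else 0)) \<and>
     (\<forall>f\<in>H. (\<forall>e\<in>B. ip f e = 0) \<longrightarrow> f = (\<lambda>_. 0))"

text \<open>
  The sum over an orthonormal basis of a Hilbert space does not depend on the choice of the
  basis, so "some basis" and "every basis" give the same notion; the existential form cannot
  hold vacuously.
\<close>

definition hilbert_schmidt_on ::
  "('a \<Rightarrow> complex) set \<Rightarrow> (('a \<Rightarrow> complex) \<Rightarrow> ('a \<Rightarrow> complex) \<Rightarrow> complex) \<Rightarrow>
   (('a \<Rightarrow> complex) \<Rightarrow> ('a \<Rightarrow> complex)) \<Rightarrow> bool" where
  "hilbert_schmidt_on H ip T \<longleftrightarrow>
     bounded_operator_on H ip T \<and>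
     (\<exists>B. orthonormal_basis_on H ip B \<and> (\<lambda>e. (ip_norm ip (T e))\<^sup>2) summable_on B)"

abbreviation unit_disc :: "complex set" where
  "unit_disc \<equiv> ball 0 1"

text \<open>
  Functions on the disc are represented by total functions that vanish off the disc, so that
  equality of functions on the disc is equality in HOL.
\<close>

definition hardy2 :: "(complex \<Rightarrow> complex) set" where
  "hardy2 = {f. f holomorphic_on unit_disc \<and> (\<forall>z. z \<notin> unit_disc \<longrightarrow> f z = 0) \<and>
               summable (\<lambda>n. (cmod ((deriv ^^ n) f 0 / fact n))\<^sup>2)}"

text \<open>Functions on the unit circle are written as functions of the angle in \<open>[0, 2\<pi>]\<close>.\<close>

abbreviation angle_measure :: "real measure" where
  "angle_measure \<equiv> lebesgue_on {0..2 * pi}"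

definition circle_L2 :: "(real \<Rightarrow> complex) set" where
  "circle_L2 = {F. F \<in> borel_measurable angle_measure \<and>
                   integrable angle_measure (\<lambda>\<theta>. (cmod (F \<theta>))\<^sup>2)}"

text \<open>
  Boundary values are taken in mean square: \<open>F\<close> is the \<open>L\<^sup>2\<close> limit of the dilates
  \<open>\<theta> \<mapsto> f (r e\<^sup>i\<^sup>\<theta>)\<close> as \<open>r\<close> increases to 1. For \<open>f\<close> in the Hardy space such an \<open>F\<close> exists and is
  unique up to null sets, and its Fourier coefficients are the Taylor coefficients of \<open>f\<close>
  (and 0 at negative indices); integrals of \<open>boundary_value f\<close> do not depend on the choice.
\<close>

definition has_boundary_value :: "(complex \<Rightarrow> complex) \<Rightarrow> (real \<Rightarrow> complex) \<Rightarrow> bool" where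
  "has_boundary_value f F \<longleftrightarrow>
     F \<in> circle_L2 \<and>
     ((\<lambda>r. \<integral>\<theta>. (cmod (f (of_real r * cis \<theta>) - F \<theta>))\<^sup>2 \<partial>angle_measure) \<longlongrightarrow> 0) (at_left (1::real))"

definition boundary_value :: "(complex \<Rightarrow> complex) \<Rightarrow> real \<Rightarrow> complex" where
  "boundary_value f = (SOME F. has_boundary_value f F)"

definition hardy2_inner :: "(complex \<Rightarrow> complex) \<Rightarrow> (complex \<Rightarrow> complex) \<Rightarrow> complex" where
  "hardy2_inner f g =
     (1 / (2 * of_real pi)) *
       (\<integral>\<theta>. boundary_value f \<theta> * cnj (boundary_value g \<theta>) \<partial>angle_measure)"

definition weighted_comp ::
  "(complex \<Rightarrow> complex) \<Rightarrow> (complex \<Rightarrow> complex) \<Rightarrow> (complex \<Rightarrow> complex) \<Rightarrow> (complex \<Rightarrow> complex)" where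
  "weighted_comp \<psi> \<tau> f = (\<lambda>z. if z \<in> unit_disc then \<psi> z * f (\<tau> z) else 0)"

end

theory Submission
  imports Defs
begin

text \<open>
  In terms of Taylor coefficients \<open>\<langle>f, g\<rangle> = \<Sum> a\<^sub>n cnj b\<^sub>n\<close>: on a circle of radius \<open>r < 1\<close> this
  is Parseval's identity for absolutely convergent series, and \<open>r\<close> may tend to 1 because the
  dilates of \<open>f\<close> are Cauchy in the complete space \<open>L\<^sup>2\<close>. Comparing integrals over circles, any
  holomorphic \<open>\<phi>\<close> with \<open>|\<phi>| \<le> C |\<psi>|\<close> satisfies \<open>\<parallel>\<phi>\<parallel> \<le> C \<parallel>\<psi>\<parallel>\<close>. If \<open>|\<tau>| \<le> \<rho> < 1\<close>, this applies
  to \<open>\<phi> = \<psi> \<cdot> (f \<circ> \<tau>)\<close>: functions in the Hardy space are bounded on \<open>|z| \<le> \<rho>\<close> by a multiple of their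
  norm, and the image of \<open>z\<^sup>n\<close> has norm at most \<open>\<rho>\<^sup>n \<parallel>\<psi>\<parallel>\<close>, which is square summable.
\<close>

subsection \<open>Square integrable functions\<close>

definition square_integrable :: "'a measure \<Rightarrow> ('a \<Rightarrow> complex) \<Rightarrow> bool" where
  "square_integrable M F \<longleftrightarrow> F \<in> borel_measurable M \<and> integrable M (\<lambda>x. (cmod (F x))\<^sup>2)"

lemma circle_L2_iff: "F \<in> circle_L2 \<longleftrightarrow> square_integrable angle_measure F"
  by (simp add: circle_L2_def square_integrable_def)

lemma square_integrable_measurable [measurable_dest]:
  "square_integrable M F \<Longrightarrow> F \<in> borel_measurable M"
  by (simp add: square_integrable_def)

lemma borel_measurable_cnj [measurable]: "cnj \<in> borel_measurable borel"
  by (intro borel_measurable_continuous_onI continuous_intros)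

text \<open>The triangle inequality followed by \<open>2ab \<le> a^2 + b^2\<close>. It replaces
  Minkowski's inequality wherever mean squares are compared, at the price of a factor 2.\<close>

lemma cmod_diff_square_le: "(cmod (a - c))\<^sup>2 \<le> 2 * (cmod (a - b))\<^sup>2 + 2 * (cmod (b - c))\<^sup>2"
proof -
  have "(cmod (a - c))\<^sup>2 \<le> (cmod (a - b) + cmod (b - c))\<^sup>2"
    by (intro power_mono) (metis diff_add_cancel add_diff_eq norm_triangle_ineq, simp)
  also have "\<dots> \<le> 2 * (cmod (a - b))\<^sup>2 + 2 * (cmod (b - c))\<^sup>2"
    using sum_squares_bound[of "cmod (a - b)" "cmod (b - c)"] by (simp add: power2_sum)
  finally show ?thesis .
qed

lemma square_integrable_diff:
  assumes F: "square_integrable M F" and G: "square_integrable M G"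
  shows "square_integrable M (\<lambda>x. F x - G x)"
proof -
  note [measurable] = F G
  have "integrable M (\<lambda>x. 2 * (cmod (F x))\<^sup>2 + 2 * (cmod (G x))\<^sup>2)"
    using F G by (auto simp: square_integrable_def)
  then have "integrable M (\<lambda>x. (cmod (F x - G x))\<^sup>2)"
    \<comment> \<open>With 0 as the intermediate point the dominating function is
      \<open>2|F|^2 + 2|G|^2\<close>.\<close>
    by (rule Bochner_Integration.integrable_bound)
       (use cmod_diff_square_le[of "F x" "G x" 0 for x] in \<open>auto intro!: AE_I2\<close>)
  then show ?thesis by (simp add: square_integrable_def)
qed

lemma integrable_mult_square_integrable:
  assumes F: "square_integrable M F" and G: "square_integrable M G"
  shows "integrable M (\<lambda>x. F x * cnj (G x))"
proof -
  note [measurable] = F G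
  have "integrable M (\<lambda>x. (cmod (F x))\<^sup>2 + (cmod (G x))\<^sup>2)"
    using F G by (auto simp: square_integrable_def)
  then show ?thesis
  proof (rule Bochner_Integration.integrable_bound)
    have "cmod (F x) * cmod (G x) \<le> (cmod (F x))\<^sup>2 + (cmod (G x))\<^sup>2" for x
      using sum_squares_bound[of "cmod (F x)" "cmod (G x)"]
        mult_nonneg_nonneg[OF norm_ge_zero norm_ge_zero, of "F x" "G x"] by linarith
    then show "AE x in M. cmod (F x * cnj (G x)) \<le> norm ((cmod (F x))\<^sup>2 + (cmod (G x))\<^sup>2)"
      by (auto simp: norm_mult)
  qed simp
qed

text \<open>Transferred from the inequality for extended nonnegative integrals; square integrability
  makes all three integrals finite, so they agree with the Bochner integrals.\<close>

lemma Cauchy_Schwarz_integral_norm: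
  assumes F: "square_integrable M F" and G: "square_integrable M G"
  shows "(\<integral>x. cmod (F x) * cmod (G x) \<partial>M)\<^sup>2 \<le> (\<integral>x. (cmod (F x))\<^sup>2 \<partial>M) * (\<integral>x. (cmod (G x))\<^sup>2 \<partial>M)"
proof -
  note [measurable] = F G
  have I: "integrable M (\<lambda>x. cmod (F x) * cmod (G x))"
    using integrable_norm[OF integrable_mult_square_integrable[OF F G]] by (simp add: norm_mult)
  have "(\<integral>\<^sup>+x. ennreal (cmod (F x)) * ennreal (cmod (G x)) \<partial>M)\<^sup>2
      \<le> (\<integral>\<^sup>+x. (ennreal (cmod (F x)))\<^sup>2 \<partial>M) * (\<integral>\<^sup>+x. (ennreal (cmod (G x)))\<^sup>2 \<partial>M)"
    by (rule Cauchy_Schwarz_nn_integral) auto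
  also have "(\<integral>\<^sup>+x. ennreal (cmod (F x)) * ennreal (cmod (G x)) \<partial>M)
      = ennreal (\<integral>x. cmod (F x) * cmod (G x) \<partial>M)"
    by (simp add: nn_integral_eq_integral I flip: ennreal_mult)
  also have "(\<integral>\<^sup>+x. (ennreal (cmod (F x)))\<^sup>2 \<partial>M) = ennreal (\<integral>x. (cmod (F x))\<^sup>2 \<partial>M)"
    using F by (simp add: nn_integral_eq_integral ennreal_power square_integrable_def)
  also have "(\<integral>\<^sup>+x. (ennreal (cmod (G x)))\<^sup>2 \<partial>M) = ennreal (\<integral>x. (cmod (G x))\<^sup>2 \<partial>M)"
    using G by (simp add: nn_integral_eq_integral ennreal_power square_integrable_def)
  finally show ?thesis
    by (simp add: ennreal_power ennreal_le_iff flip: ennreal_mult)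
qed

lemma Cauchy_Schwarz_integral:
  assumes F: "square_integrable M F" and G: "square_integrable M G"
  shows "cmod (\<integral>x. F x * cnj (G x) \<partial>M)
    \<le> sqrt (\<integral>x. (cmod (F x))\<^sup>2 \<partial>M) * sqrt (\<integral>x. (cmod (G x))\<^sup>2 \<partial>M)"
proof -
  have "cmod (\<integral>x. F x * cnj (G x) \<partial>M) \<le> (\<integral>x. cmod (F x) * cmod (G x) \<partial>M)"
    using integral_norm_bound[of M "\<lambda>x. F x * cnj (G x)"] by (simp add: norm_mult)
  also have "\<dots> \<le> sqrt (\<integral>x. (cmod (F x))\<^sup>2 \<partial>M) * sqrt (\<integral>x. (cmod (G x))\<^sup>2 \<partial>M)"
    using Cauchy_Schwarz_integral_norm[OF F G] by (metis real_le_rsqrt real_sqrt_mult)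
  finally show ?thesis .
qed

text \<open>Continuity of the \<open>L^2\<close> inner product in both arguments. It later carries
  integrals over circles of radius \<open>r\<close> to boundary values.\<close>

lemma tendsto_integral_mult_cnj:
  assumes F: "square_integrable M F" and G: "square_integrable M G"
    and u: "\<forall>\<^sub>F r in \<A>. square_integrable M (u r)" and v: "\<forall>\<^sub>F r in \<A>. square_integrable M (v r)"
    and uF: "((\<lambda>r. \<integral>x. (cmod (u r x - F x))\<^sup>2 \<partial>M) \<longlongrightarrow> 0) \<A>"
    and vG: "((\<lambda>r. \<integral>x. (cmod (v r x - G x))\<^sup>2 \<partial>M) \<longlongrightarrow> 0) \<A>"
  shows "((\<lambda>r. \<integral>x. u r x * cnj (v r x) \<partial>M) \<longlongrightarrow> (\<integral>x. F x * cnj (G x) \<partial>M)) \<A>"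
proof (rule LIM_zero_cancel, rule Lim_null_comparison)
  let ?N = "\<lambda>H. sqrt (\<integral>x. (cmod (H x))\<^sup>2 \<partial>M)"
  \<comment> \<open>Writing \<open>u = (u - F) + F\<close> and \<open>v = (v - G) + G\<close> leaves
    three error products; Cauchy-Schwarz bounds each one. Every summand of \<open>?B\<close>
    contains a factor that tends to 0.\<close>
  let ?B = "\<lambda>r. ?N (\<lambda>x. u r x - F x) * ?N (\<lambda>x. v r x - G x) + ?N (\<lambda>x. u r x - F x) * ?N G
      + ?N F * ?N (\<lambda>x. v r x - G x)"
  show "\<forall>\<^sub>F r in \<A>. norm ((\<integral>x. u r x * cnj (v r x) \<partial>M) - (\<integral>x. F x * cnj (G x) \<partial>M)) \<le> ?B r"
    using u v
  proof eventually_elim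
    case (elim r)
    have uF': "square_integrable M (\<lambda>x. u r x - F x)" and vG': "square_integrable M (\<lambda>x. v r x - G x)"
      using elim F G by (auto intro: square_integrable_diff)
    have split: "(\<integral>x. u r x * cnj (v r x) \<partial>M) - (\<integral>x. F x * cnj (G x) \<partial>M)
      = (\<integral>x. (u r x - F x) * cnj (v r x - G x) \<partial>M) + (\<integral>x. (u r x - F x) * cnj (G x) \<partial>M)
        + (\<integral>x. F x * cnj (v r x - G x) \<partial>M)"
    proof -
      let ?A = "\<lambda>x. (u r x - F x) * cnj (v r x - G x)" and ?C = "\<lambda>x. (u r x - F x) * cnj (G x)"
        and ?D = "\<lambda>x. F x * cnj (v r x - G x)"
      have A: "integrable M ?A" and C: "integrable M ?C" and D: "integrable M ?D"
        by (rule integrable_mult_square_integrable uF' vG' F G)+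
      have "(\<integral>x. u r x * cnj (v r x) \<partial>M) - (\<integral>x. F x * cnj (G x) \<partial>M)
          = (\<integral>x. u r x * cnj (v r x) - F x * cnj (G x) \<partial>M)"
        using elim F G
        by (intro Bochner_Integration.integral_diff[symmetric] integrable_mult_square_integrable)
      also have "(\<lambda>x. u r x * cnj (v r x) - F x * cnj (G x)) = (\<lambda>x. ?A x + ?C x + ?D x)"
        by (simp add: fun_eq_iff algebra_simps)
      finally show ?thesis
        by (simp only: Bochner_Integration.integral_add Bochner_Integration.integrable_add A C D)
    qed
    show ?case
      unfolding split
      using Cauchy_Schwarz_integral[OF uF' vG'] Cauchy_Schwarz_integral[OF uF' G]
        Cauchy_Schwarz_integral[OF F vG']
      by (intro order.trans[OF norm_triangle_ineq] add_mono)
  qed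
  have "(?B \<longlongrightarrow> sqrt 0 * sqrt 0 + sqrt 0 * ?N G + ?N F * sqrt 0) \<A>"
    by (intro tendsto_add tendsto_mult tendsto_real_sqrt tendsto_const uF vG)
  then show "(?B \<longlongrightarrow> 0) \<A>" by simp
qed

text \<open>Cauchy-Schwarz against the constant function 1, which is square integrable because the
  measure is finite.\<close>

lemma (in finite_measure) L1_square_le:
  assumes F: "square_integrable M F"
  shows "integrable M F" "(\<integral>x. cmod (F x) \<partial>M)\<^sup>2 \<le> measure M (space M) * (\<integral>x. (cmod (F x))\<^sup>2 \<partial>M)"
proof -
  have 1: "square_integrable M (\<lambda>_. 1)" by (simp add: square_integrable_def)
  show "integrable M F"
    using integrable_mult_square_integrable[OF F 1] by simp
  show "(\<integral>x. cmod (F x) \<partial>M)\<^sup>2 \<le> measure M (space M) * (\<integral>x. (cmod (F x))\<^sup>2 \<partial>M)"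
    using Cauchy_Schwarz_integral_norm[OF F 1] by (simp add: mult.commute)
qed

text \<open>Riesz-Fischer. On a finite measure space an \<open>L^2\<close> Cauchy sequence is Cauchy
  in \<open>L^1\<close>, so a subsequence converges almost everywhere; Fatou's lemma shows that its
  pointwise limit is the \<open>L^2\<close> limit of the whole sequence.\<close>

lemma (in finite_measure) L2_complete:
  assumes s: "\<And>n. square_integrable M (s n)"
    and Cauchy: "\<And>e. e > 0 \<Longrightarrow> \<exists>N. \<forall>i\<ge>N. \<forall>j\<ge>N. (\<integral>x. (cmod (s i x - s j x))\<^sup>2 \<partial>M) < e"
  obtains F where "square_integrable M F" "(\<lambda>n. \<integral>x. (cmod (s n x - F x))\<^sup>2 \<partial>M) \<longlonglongrightarrow> 0"
proof -
  note [measurable] = s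
  have sd: "square_integrable M (\<lambda>x. s i x - s j x)" for i j
    by (intro square_integrable_diff s)
  have "\<exists>N. \<forall>i\<ge>N. \<forall>j\<ge>N. (\<integral>x. cmod (s i x - s j x) \<partial>M) < e" if e: "e > 0" for e
  proof -
    \<comment> \<open>Adding 1 keeps the divisor positive even if the whole space is a null
      set.\<close>
    let ?m = "measure M (space M) + 1"
    have m: "?m > 0" by (simp add: add_nonneg_pos)
    then obtain N where N: "\<And>i j. i \<ge> N \<Longrightarrow> j \<ge> N \<Longrightarrow> (\<integral>x. (cmod (s i x - s j x))\<^sup>2 \<partial>M) < e\<^sup>2 / ?m"
      using Cauchy[of "e\<^sup>2 / ?m"] e by auto
    have "(\<integral>x. cmod (s i x - s j x) \<partial>M) < e" if "i \<ge> N" "j \<ge> N" for i j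
    proof -
      have "(\<integral>x. cmod (s i x - s j x) \<partial>M)\<^sup>2 \<le> measure M (space M) * (\<integral>x. (cmod (s i x - s j x))\<^sup>2 \<partial>M)"
        by (rule L1_square_le[OF sd])
      also have "\<dots> \<le> ?m * (\<integral>x. (cmod (s i x - s j x))\<^sup>2 \<partial>M)"
        by (intro mult_right_mono) auto
      also have "\<dots> < e\<^sup>2"
        using N[OF that] m by (simp add: field_simps)
      finally show ?thesis
        using e by (simp add: power_less_imp_less_base)
    qed
    then show ?thesis by blast
  qed
  then obtain r :: "nat \<Rightarrow> nat" where r: "strict_mono r" and AE: "AE x in M. Cauchy (\<lambda>i. s (r i) x)"
    using cauchy_L1_AE_cauchy_subseq[of M s] L1_square_le(1)[OF s] by blast
  \<comment> \<open>Where the subsequence diverges \<open>lim\<close> is an unspecified value; this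
    happens only on a null set.\<close>
  define F where "F x = lim (\<lambda>i. s (r i) x)" for x
  have F_meas [measurable]: "F \<in> borel_measurable M"
    unfolding F_def by measurable
  have lim: "AE x in M. (\<lambda>i. s (r i) x) \<longlonglongrightarrow> F x"
    using AE by eventually_elim (simp add: F_def Cauchy_convergent convergent_LIMSEQ_iff[symmetric])
  \<comment> \<open>The index \<open>n\<close> stays fixed while the other one runs along the
    subsequence. Since \<open>i \<le> r i\<close>, the Cauchy bound applies to \<open>r i\<close> as
    soon as \<open>N \<le> i\<close>.\<close>
  have Fatou: "(\<integral>\<^sup>+x. ennreal ((cmod (s n x - F x))\<^sup>2) \<partial>M) \<le> ennreal e"
    if "N \<le> n" and N: "\<And>i j. i \<ge> N \<Longrightarrow> j \<ge> N \<Longrightarrow> (\<integral>x. (cmod (s i x - s j x))\<^sup>2 \<partial>M) < e" for n N e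
  proof -
    have "AE x in M. ennreal ((cmod (s n x - F x))\<^sup>2) = liminf (\<lambda>i. ennreal ((cmod (s n x - s (r i) x))\<^sup>2))"
      using lim
    proof eventually_elim
      case (elim x)
      have "(\<lambda>i. ennreal ((cmod (s n x - s (r i) x))\<^sup>2)) \<longlonglongrightarrow> ennreal ((cmod (s n x - F x))\<^sup>2)"
        by (intro tendsto_intros elim tendsto_ennrealI)
      then show ?case by (simp only: lim_imp_Liminf[OF sequentially_bot])
    qed
    then have "(\<integral>\<^sup>+x. ennreal ((cmod (s n x - F x))\<^sup>2) \<partial>M)
        = (\<integral>\<^sup>+x. liminf (\<lambda>i. ennreal ((cmod (s n x - s (r i) x))\<^sup>2)) \<partial>M)"
      by (rule nn_integral_cong_AE)
    also have "\<dots> \<le> liminf (\<lambda>i. \<integral>\<^sup>+x. ennreal ((cmod (s n x - s (r i) x))\<^sup>2) \<partial>M)"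
      by (rule nn_integral_liminf) measurable
    also have "\<dots> \<le> ennreal e"
    proof (rule Liminf_le)
      show "\<forall>\<^sub>F i in sequentially. (\<integral>\<^sup>+x. ennreal ((cmod (s n x - s (r i) x))\<^sup>2) \<partial>M) \<le> ennreal e"
      proof (rule eventually_sequentiallyI)
        fix i assume "N \<le> i"
        then have "N \<le> r i" using seq_suble[OF r, of i] by simp
        then show "(\<integral>\<^sup>+x. ennreal ((cmod (s n x - s (r i) x))\<^sup>2) \<partial>M) \<le> ennreal e"
          using N[of n "r i"] \<open>N \<le> n\<close> sd[of n "r i"]
          by (subst nn_integral_eq_integral) (auto simp: square_integrable_def intro!: ennreal_leI)
      qed
    qed simp
    finally show ?thesis .
  qed
  have sF: "square_integrable M (\<lambda>x. s n x - F x)"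
    and bound: "(\<integral>x. (cmod (s n x - F x))\<^sup>2 \<partial>M) \<le> e"
    if "N \<le> n" "e > 0" "\<And>i j. i \<ge> N \<Longrightarrow> j \<ge> N \<Longrightarrow> (\<integral>x. (cmod (s i x - s j x))\<^sup>2 \<partial>M) < e" for n N e
  proof -
    have *: "(\<integral>\<^sup>+x. ennreal ((cmod (s n x - F x))\<^sup>2) \<partial>M) \<le> ennreal e"
      using that by (intro Fatou[of N]) auto
    have "(\<integral>\<^sup>+x. ennreal ((cmod (s n x - F x))\<^sup>2) \<partial>M) < \<infinity>"
      using * by (auto intro: le_less_trans)
    then have i: "integrable M (\<lambda>x. (cmod (s n x - F x))\<^sup>2)"
      by (intro integrableI_bounded) auto
    then show "square_integrable M (\<lambda>x. s n x - F x)"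
      by (simp add: square_integrable_def)
    show "(\<integral>x. (cmod (s n x - F x))\<^sup>2 \<partial>M) \<le> e"
      using * \<open>e > 0\<close> by (subst (asm) nn_integral_eq_integral[OF i]) auto
  qed
  show thesis
  proof
    \<comment> \<open>Any tolerance would do here: one square integrable difference
      \<open>s N - F\<close> suffices, since \<open>F = s N - (s N - F)\<close>.\<close>
    obtain N where "\<And>i j. i \<ge> N \<Longrightarrow> j \<ge> N \<Longrightarrow> (\<integral>x. (cmod (s i x - s j x))\<^sup>2 \<partial>M) < 1"
      using Cauchy[of 1] by auto
    then have "square_integrable M (\<lambda>x. s N x - F x)"
      by (intro sF[of N N 1]) auto
    from square_integrable_diff[OF s[of N] this] show "square_integrable M F" by simp
    show "(\<lambda>n. \<integral>x. (cmod (s n x - F x))\<^sup>2 \<partial>M) \<longlonglongrightarrow> 0"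
    proof (rule LIMSEQ_I)
      fix e :: real assume e: "e > 0"
      \<comment> \<open>Passing to the limit yields only a weak inequality, so \<open>e / 2\<close>
        is used to end strictly below \<open>e\<close>.\<close>
      then obtain N where N: "\<And>i j. i \<ge> N \<Longrightarrow> j \<ge> N \<Longrightarrow> (\<integral>x. (cmod (s i x - s j x))\<^sup>2 \<partial>M) < e / 2"
        using Cauchy[of "e / 2"] by auto
      have "norm ((\<integral>x. (cmod (s n x - F x))\<^sup>2 \<partial>M) - 0) < e" if "n \<ge> N" for n
        using bound[OF that _ N] e by simp
      then show "\<exists>N. \<forall>n\<ge>N. norm ((\<integral>x. (cmod (s n x - F x))\<^sup>2 \<partial>M) - 0) < e" by blast
    qed
  qed
qed

subsection \<open>Parseval on circles of radius less than 1\<close>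

lemma finite_measure_angle: "finite_measure angle_measure"
  by (intro finite_measure_lebesgue_on) auto

lemma measure_angle: "measure angle_measure (space angle_measure) = 2 * pi"
  by (simp add: measure_restrict_space)

lemma square_integrable_angle_continuous:
  assumes "continuous_on {0..2 * pi} F"
  shows "square_integrable angle_measure F"
proof -
  have "(\<lambda>\<theta>. (cmod (F \<theta>))\<^sup>2) absolutely_integrable_on {0..2 * pi}"
    by (intro absolutely_integrable_continuous_real continuous_intros assms)
  then have "integrable angle_measure (\<lambda>\<theta>. (cmod (F \<theta>))\<^sup>2)"
    by (simp add: set_integrable_def integrable_restrict_space)
  then show ?thesis
    using continuous_imp_measurable_on_sets_lebesgue[OF assms] by (simp add: square_integrable_def)
qed

text \<open>Orthogonality of the characters: for \<open>m \<noteq> n\<close> the product is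
  \<open>cis (k * \<theta>)\<close> with a nonzero integer \<open>k\<close>, and its antiderivative
  has period \<open>2 * pi\<close>.\<close>

lemma integral_cis_mult_cnj_cis:
  "(\<integral>\<theta>. cis (real m * \<theta>) * cnj (cis (real n * \<theta>)) \<partial>angle_measure) = (if m = n then 2 * of_real pi else 0)"
proof (cases "m = n")
  case True
  then show ?thesis
    using measure_angle by (simp add: cis_cnj cis_mult scaleR_conv_of_real)
next
  case False
  define k where "k = real m - real n"
  have k: "k \<noteq> 0" using False by (simp add: k_def)
  have "((\<lambda>\<theta>. cis (k * \<theta>) / (\<i> * of_real k)) has_vector_derivative cis (k * \<theta>)) (at \<theta> within {0..2 * pi})" for \<theta>
  proof -
    have "((\<lambda>z. exp (\<i> * of_real k * z) / (\<i> * of_real k)) has_field_derivative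
        exp (\<i> * of_real k * of_real \<theta>)) (at (of_real \<theta>))"
      using k by (auto intro!: derivative_eq_intros)
    from has_vector_derivative_real_field[OF this] show ?thesis
      by (simp add: cis_conv_exp mult.assoc)
  qed
  then have "((\<lambda>\<theta>. cis (k * \<theta>)) has_integral
      cis (k * (2 * pi)) / (\<i> * of_real k) - cis (k * 0) / (\<i> * of_real k)) {0..2 * pi}"
    by (intro fundamental_theorem_of_calculus) auto
  moreover have "cis (k * (2 * pi)) = 1"
  proof -
    have "k * (2 * pi) = 2 * pi * of_int (int m - int n)" by (simp add: k_def)
    then show ?thesis by (simp only: cis_multiple_2pi Ints_of_int)
  qed
  ultimately have "((\<lambda>\<theta>. cis (k * \<theta>)) has_integral 0) {0..2 * pi}" by simp
  moreover
  \<comment> \<open>The fundamental theorem gives a gauge integral; integrability identifies it with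
    the Lebesgue integral.\<close>
  have "integrable angle_measure (\<lambda>\<theta>. cis (k * \<theta>))"
    by (rule finite_measure.L1_square_le[OF finite_measure_angle])
       (auto intro!: square_integrable_angle_continuous continuous_intros)
  then have "((\<lambda>\<theta>. cis (k * \<theta>)) has_integral (\<integral>\<theta>. cis (k * \<theta>) \<partial>angle_measure)) {0..2 * pi}"
    by (rule has_integral_integral_lebesgue_on) simp
  ultimately have "(\<integral>\<theta>. cis (k * \<theta>) \<partial>angle_measure) = 0"
    using has_integral_unique by blast
  then show ?thesis
    using False by (simp add: cis_cnj cis_mult k_def algebra_simps)
qed

lemma continuous_on_cis_series:
  assumes "summable (\<lambda>n. cmod (u n))"
  shows "continuous_on A (\<lambda>\<theta>. \<Sum>n. u n * cis (real n * \<theta>))"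
proof (rule uniform_limit_theorem)
  show "uniform_limit A (\<lambda>N \<theta>. \<Sum>n<N. u n * cis (real n * \<theta>)) (\<lambda>\<theta>. \<Sum>n. u n * cis (real n * \<theta>)) sequentially"
    using assms by (intro Weierstrass_m_test) (auto simp: norm_mult)
qed (auto intro!: continuous_intros always_eventually)

text \<open>Termwise integration: each term is bounded in modulus by \<open>|u n| |h|\<close>, so
  the integrals of the norms form a summable series.\<close>

lemma integral_cis_series_mult:
  assumes u: "summable (\<lambda>n. cmod (u n))" and h: "continuous_on {0..2 * pi} h"
  shows "(\<lambda>n. u n * (\<integral>\<theta>. cis (real n * \<theta>) * h \<theta> \<partial>angle_measure)) sums
    (\<integral>\<theta>. (\<Sum>n. u n * cis (real n * \<theta>)) * h \<theta> \<partial>angle_measure)"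
proof -
  have hi: "integrable angle_measure h"
    by (intro finite_measure.L1_square_le[OF finite_measure_angle] square_integrable_angle_continuous h)
  have i: "integrable angle_measure (\<lambda>\<theta>. u n * (cis (real n * \<theta>) * h \<theta>))" for n
    by (rule finite_measure.L1_square_le[OF finite_measure_angle])
       (auto intro!: square_integrable_angle_continuous continuous_intros h)
  have "(\<lambda>n. \<integral>\<theta>. u n * (cis (real n * \<theta>) * h \<theta>) \<partial>angle_measure) sums
      (\<integral>\<theta>. (\<Sum>n. u n * (cis (real n * \<theta>) * h \<theta>)) \<partial>angle_measure)"
  proof (rule sums_integral[OF i])
    show "AE \<theta> in angle_measure. summable (\<lambda>n. norm (u n * (cis (real n * \<theta>) * h \<theta>)))"
      using u by (auto simp: norm_mult simp flip: mult.assoc intro!: AE_I2 summable_mult2)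
    show "summable (\<lambda>n. \<integral>\<theta>. norm (u n * (cis (real n * \<theta>) * h \<theta>)) \<partial>angle_measure)"
      using summable_mult2[OF u, of "\<integral>\<theta>. cmod (h \<theta>) \<partial>angle_measure"] hi by (simp add: norm_mult)
  qed
  moreover have "(\<Sum>n. u n * (cis (real n * \<theta>) * h \<theta>)) = (\<Sum>n. u n * cis (real n * \<theta>)) * h \<theta>" for \<theta>
  proof -
    have "summable (\<lambda>n. u n * cis (real n * \<theta>))"
      using u by (intro summable_norm_cancel[where f = "\<lambda>n. u n * cis (real n * \<theta>)"]) (simp add: norm_mult)
    from suminf_mult2[OF this, of "h \<theta>"] show ?thesis by (simp add: mult.assoc)
  qed
  ultimately show ?thesis by simp
qed

text \<open>Termwise integration is applied twice. Integrating the series of \<open>v\<close>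
  against one character leaves a single term by orthogonality; the conjugates of these values are
  then summed against \<open>u\<close>.\<close>

lemma Parseval_cis_series:
  assumes u: "summable (\<lambda>n. cmod (u n))" and v: "summable (\<lambda>n. cmod (v n))"
  shows "(\<lambda>n. 2 * of_real pi * (u n * cnj (v n))) sums
    (\<integral>\<theta>. (\<Sum>n. u n * cis (real n * \<theta>)) * cnj (\<Sum>n. v n * cis (real n * \<theta>)) \<partial>angle_measure)"
proof -
  let ?V = "\<lambda>\<theta>. \<Sum>n. v n * cis (real n * \<theta>)"
  have "(\<integral>\<theta>. cis (real m * \<theta>) * cnj (?V \<theta>) \<partial>angle_measure) = 2 * of_real pi * cnj (v m)" for m
  proof -
    have "(\<lambda>n. v n * (\<integral>\<theta>. cis (real n * \<theta>) * cnj (cis (real m * \<theta>)) \<partial>angle_measure)) sums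
        (\<integral>\<theta>. ?V \<theta> * cnj (cis (real m * \<theta>)) \<partial>angle_measure)"
      by (rule integral_cis_series_mult[OF v]) (auto intro!: continuous_intros)
    then have "(\<lambda>n. if n = m then v m * (2 * of_real pi) else 0) sums
        (\<integral>\<theta>. ?V \<theta> * cnj (cis (real m * \<theta>)) \<partial>angle_measure)"
      unfolding integral_cis_mult_cnj_cis by (rule sums_cong[THEN iffD1, rotated]) auto
    then have "(\<integral>\<theta>. ?V \<theta> * cnj (cis (real m * \<theta>)) \<partial>angle_measure) = v m * (2 * of_real pi)"
      using sums_single[of m "\<lambda>_. v m * (2 * of_real pi)"] sums_unique2 by blast
    then have "2 * of_real pi * cnj (v m) = cnj (\<integral>\<theta>. ?V \<theta> * cnj (cis (real m * \<theta>)) \<partial>angle_measure)"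
      by simp
    also have "\<dots> = (\<integral>\<theta>. cnj (?V \<theta> * cnj (cis (real m * \<theta>))) \<partial>angle_measure)"
      by (rule Bochner_Integration.integral_cnj[symmetric])
    also have "\<dots> = (\<integral>\<theta>. cis (real m * \<theta>) * cnj (?V \<theta>) \<partial>angle_measure)"
      by (simp only: complex_cnj_mult complex_cnj_cnj mult.commute)
    finally show ?thesis ..
  qed
  moreover have "continuous_on {0..2 * pi} (\<lambda>\<theta>. cnj (?V \<theta>))"
    by (intro continuous_on_cnj continuous_on_cis_series v)
  ultimately show ?thesis
    using integral_cis_series_mult[OF u, of "\<lambda>\<theta>. cnj (?V \<theta>)"] by (simp add: mult.left_commute)
qed

section \<open>Taylor coefficients and dilates of holomorphic functions\<close>

definition taylor_coeff :: "(complex \<Rightarrow> complex) \<Rightarrow> nat \<Rightarrow> complex" where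
  "taylor_coeff f n = (deriv ^^ n) f 0 / fact n"

lemma taylor_series_sums:
  assumes "f holomorphic_on unit_disc" "z \<in> unit_disc"
  shows "(\<lambda>n. taylor_coeff f n * z ^ n) sums f z"
  using holomorphic_power_series[OF assms] by (simp add: taylor_coeff_def)

text \<open>Abel's lemma: convergence at a radius strictly between \<open>|z|\<close> and 1 forces
  absolute convergence at \<open>z\<close>.\<close>

lemma summable_norm_taylor_series:
  assumes f: "f holomorphic_on unit_disc" and z: "z \<in> unit_disc"
  shows "summable (\<lambda>n. cmod (taylor_coeff f n * z ^ n))"
proof -
  obtain r where r: "cmod z < r" "r < 1" using z dense[of "cmod z" 1] by auto
  have "summable (\<lambda>n. taylor_coeff f n * of_real r ^ n)"
    using taylor_series_sums[OF f, of "of_real r"] r norm_ge_zero[of z]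
    by (auto simp: sums_iff)
  then show ?thesis
    by (rule powser_insidea) (use r norm_ge_zero[of z] in auto)
qed

text \<open>By de Moivre's formula the radius is absorbed into the coefficients, which become
  absolutely summable; the dilate is then a Fourier series to which Parseval applies.\<close>

lemma dilate_eq_cis_series:
  assumes f: "f holomorphic_on unit_disc" and r: "0 < r" "r < 1"
  shows "f (of_real r * cis \<theta>) = (\<Sum>n. (taylor_coeff f n * of_real r ^ n) * cis (real n * \<theta>))"
  using taylor_series_sums[OF f, of "of_real r * cis \<theta>"] r
  by (simp add: sums_iff norm_mult power_mult_distrib mult.assoc flip: Complex.DeMoivre)

lemma summable_dilate:
  assumes f: "f holomorphic_on unit_disc" and r: "0 < r" "r < 1"
  shows "summable (\<lambda>n. cmod (taylor_coeff f n * of_real r ^ n))"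
  using summable_norm_taylor_series[OF f, of "of_real r"] r by simp

lemma square_integrable_dilate:
  assumes f: "f holomorphic_on unit_disc" and r: "0 < r" "r < 1"
  shows "square_integrable angle_measure (\<lambda>\<theta>. f (of_real r * cis \<theta>))"
  unfolding dilate_eq_cis_series[OF assms]
  by (intro square_integrable_angle_continuous continuous_on_cis_series summable_dilate assms)

lemma Parseval_dilate:
  assumes f: "f holomorphic_on unit_disc" and g: "g holomorphic_on unit_disc" and r: "0 < r" "r < 1"
  shows "(\<lambda>n. taylor_coeff f n * cnj (taylor_coeff g n) * of_real ((r ^ n)\<^sup>2)) sums
    (1 / (2 * of_real pi) * (\<integral>\<theta>. f (of_real r * cis \<theta>) * cnj (g (of_real r * cis \<theta>)) \<partial>angle_measure))"
proof -
  have "(\<lambda>n. 1 / (2 * of_real pi) * (2 * of_real pi * (taylor_coeff f n * of_real r ^ n *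
        cnj (taylor_coeff g n * of_real r ^ n)))) sums
      (1 / (2 * of_real pi) * (\<integral>\<theta>. f (of_real r * cis \<theta>) * cnj (g (of_real r * cis \<theta>)) \<partial>angle_measure))"
    unfolding dilate_eq_cis_series[OF f r] dilate_eq_cis_series[OF g r]
    by (intro sums_mult Parseval_cis_series summable_dilate f g r)
  moreover have "1 / (2 * of_real pi) * (2 * of_real pi * (taylor_coeff f n * of_real r ^ n *
        cnj (taylor_coeff g n * of_real r ^ n)))
      = taylor_coeff f n * cnj (taylor_coeff g n) * of_real ((r ^ n)\<^sup>2)" for n
    by (simp add: power2_eq_square)
  ultimately show ?thesis by (simp only:)
qed

text \<open>The difference of two dilates is again an absolutely convergent series in
  \<open>cis (real n * \<theta>)\<close>, with coefficients \<open>a_n (r^n - s^n)\<close>; Parseval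
  is applied to it with itself.\<close>

lemma integral_dilate_diff:
  assumes f: "f holomorphic_on unit_disc" and r: "0 < r" "r < 1" and s: "0 < s" "s < 1"
  shows "(\<lambda>n. 2 * pi * ((cmod (taylor_coeff f n))\<^sup>2 * (r ^ n - s ^ n)\<^sup>2)) sums
    (\<integral>\<theta>. (cmod (f (of_real r * cis \<theta>) - f (of_real s * cis \<theta>)))\<^sup>2 \<partial>angle_measure)"
proof -
  define u where "u n = taylor_coeff f n * of_real r ^ n - taylor_coeff f n * of_real s ^ n" for n
  have u: "summable (\<lambda>n. cmod (u n))"
    by (rule summable_comparison_test_ev[OF _ summable_add[OF summable_dilate[OF f r] summable_dilate[OF f s]]])
       (auto simp: u_def norm_triangle_ineq4)
  have U: "f (of_real r * cis \<theta>) - f (of_real s * cis \<theta>) = (\<Sum>n. u n * cis (real n * \<theta>))" for \<theta>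
  proof -
    have "summable (\<lambda>n. (taylor_coeff f n * of_real q ^ n) * cis (real n * \<theta>))" if "0 < q" "q < 1" for q :: real
      by (rule summable_norm_cancel) (use summable_dilate[OF f that] in \<open>simp add: norm_mult\<close>)
    from suminf_diff[OF this[OF r] this[OF s]] show ?thesis
      by (simp add: dilate_eq_cis_series[OF f r] dilate_eq_cis_series[OF f s] u_def left_diff_distrib)
  qed
  have "(\<lambda>n. Re (2 * of_real pi * (u n * cnj (u n)))) sums
      Re (\<integral>\<theta>. of_real ((cmod (f (of_real r * cis \<theta>) - f (of_real s * cis \<theta>)))\<^sup>2) \<partial>angle_measure)"
    using sums_Re[OF Parseval_cis_series[OF u u]] by (simp add: U flip: complex_norm_square)
  moreover have "Re (2 * of_real pi * (u n * cnj (u n)))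
      = 2 * pi * ((cmod (taylor_coeff f n))\<^sup>2 * (r ^ n - s ^ n)\<^sup>2)" for n
  proof -
    have "u n = taylor_coeff f n * of_real (r ^ n - s ^ n)"
      by (simp add: u_def right_diff_distrib)
    then have "cmod (u n) = cmod (taylor_coeff f n) * \<bar>r ^ n - s ^ n\<bar>"
      by (simp only: norm_mult norm_of_real)
    moreover have "2 * of_real pi * (u n * cnj (u n)) = of_real (2 * pi * (cmod (u n))\<^sup>2)"
      by (simp add: complex_norm_square del: of_real_power)
    ultimately show ?thesis by (simp add: power_mult_distrib)
  qed
  ultimately show ?thesis by (simp only: integral_complex_of_real Re_complex_of_real)
qed

subsection \<open>Boundary values and Taylor coefficients\<close>

lemma hardy2D:
  assumes "f \<in> hardy2"
  shows "f holomorphic_on unit_disc" "z \<notin> unit_disc \<Longrightarrow> f z = 0"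
    "summable (\<lambda>n. (cmod (taylor_coeff f n))\<^sup>2)"
  using assms by (auto simp: hardy2_def taylor_coeff_def)

text \<open>Tannery's theorem, that is, dominated convergence for series. A bound for
  \<open>0 < r < 1\<close> is enough, since such radii form a left neighbourhood of 1.\<close>

lemma tendsto_suminf_at_left_1:
  fixes a :: "nat \<Rightarrow> real \<Rightarrow> 'a :: {real_normed_algebra, banach}"
  assumes "\<And>n. (a n \<longlongrightarrow> b n) (at_left 1)" "summable B"
    and "\<And>n r. 0 < r \<Longrightarrow> r < 1 \<Longrightarrow> norm (a n r) \<le> B n"
  shows "((\<lambda>r. \<Sum>n. a n r) \<longlongrightarrow> (\<Sum>n. b n)) (at_left 1)"
proof -
  have "\<forall>\<^sub>F (n, r) in at_top \<times>\<^sub>F at_left 1. norm (a n r) \<le> B n"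
    unfolding eventually_prod_filter
    by (rule exI[of _ "\<lambda>_. True"], rule exI[of _ "\<lambda>r. 0 < r \<and> r < 1"])
       (use assms(3) in \<open>auto intro: eventually_at_left_1\<close>)
  from tannerys_theorem[OF assms(1) this assms(2)] show ?thesis by simp
qed

lemma tendsto_dilation_error:
  assumes "summable (\<lambda>n. (cmod (a n))\<^sup>2)"
  shows "((\<lambda>r::real. \<Sum>n. (cmod (a n))\<^sup>2 * (1 - r ^ n)\<^sup>2) \<longlongrightarrow> 0) (at_left 1)"
proof -
  have "((\<lambda>r::real. \<Sum>n. (cmod (a n))\<^sup>2 * (1 - r ^ n)\<^sup>2) \<longlongrightarrow> (\<Sum>n. (cmod (a n))\<^sup>2 * (1 - 1 ^ n)\<^sup>2)) (at_left 1)"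
  proof (rule tendsto_suminf_at_left_1[OF _ assms])
    show "norm ((cmod (a n))\<^sup>2 * (1 - r ^ n)\<^sup>2) \<le> (cmod (a n))\<^sup>2" if "0 < r" "r < 1" for n and r :: real
      using that by (auto intro!: mult_left_le power_le_one simp: abs_mult)
  qed (intro tendsto_intros)
  then show ?thesis by simp
qed

text \<open>From \<open>r^n \<le> s^n \<le> 1\<close> each Parseval term is at most its value at
  \<open>s = 1\<close>. The bound is uniform in \<open>s\<close>, which makes the dilates a Cauchy
  family.\<close>

lemma integral_dilate_diff_le:
  assumes f: "f \<in> hardy2" and r: "0 < r" and s: "r \<le> s" "s < 1"
  shows "(\<integral>\<theta>. (cmod (f (of_real r * cis \<theta>) - f (of_real s * cis \<theta>)))\<^sup>2 \<partial>angle_measure)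
    \<le> 2 * pi * (\<Sum>n. (cmod (taylor_coeff f n))\<^sup>2 * (1 - r ^ n)\<^sup>2)"
proof -
  have mono: "(s ^ n - r ^ n)\<^sup>2 \<le> (1 - r ^ n)\<^sup>2" for n
    using r s by (intro power_mono) (auto intro: power_mono power_le_one)
  have "summable (\<lambda>n. (cmod (taylor_coeff f n))\<^sup>2 * (1 - r ^ n)\<^sup>2)"
    by (rule summable_comparison_test_ev[OF _ hardy2D(3)[OF f]])
       (use r s in \<open>auto intro!: always_eventually mult_left_le power_le_one simp: abs_mult\<close>)
  then have B: "(\<lambda>n. 2 * pi * ((cmod (taylor_coeff f n))\<^sup>2 * (1 - r ^ n)\<^sup>2)) sums
      (2 * pi * (\<Sum>n. (cmod (taylor_coeff f n))\<^sup>2 * (1 - r ^ n)\<^sup>2))"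
    by (intro sums_mult summable_sums)
  have A: "(\<lambda>n. 2 * pi * ((cmod (taylor_coeff f n))\<^sup>2 * (r ^ n - s ^ n)\<^sup>2)) sums
      (\<integral>\<theta>. (cmod (f (of_real r * cis \<theta>) - f (of_real s * cis \<theta>)))\<^sup>2 \<partial>angle_measure)"
    by (rule integral_dilate_diff) (use f r s in \<open>auto intro: hardy2D\<close>)
  show ?thesis
    by (rule sums_le[OF _ A B])
       (use mono in \<open>auto intro!: mult_left_mono simp: power2_commute[of "r ^ _" "s ^ _"]\<close>)
qed

text \<open>
  The \<open>L\<^sup>2\<close> limit \<open>F\<close> is first found along one sequence of radii; the dilation error \<open>E r\<close> then
  controls all radii.
\<close>

lemma has_boundary_value_exists:
  assumes f: "f \<in> hardy2"
  obtains F where "has_boundary_value f F"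
proof -
  let ?f = "\<lambda>r \<theta>. f (of_real r * cis \<theta>)"
  define E where "E r = 2 * pi * (\<Sum>n. (cmod (taylor_coeff f n))\<^sup>2 * (1 - r ^ n)\<^sup>2)" for r
  have E: "(E \<longlongrightarrow> 0) (at_left 1)"
    unfolding E_def by (intro tendsto_mult_right_zero tendsto_dilation_error hardy2D f)
  have fE: "(\<integral>\<theta>. (cmod (?f r \<theta> - ?f s \<theta>))\<^sup>2 \<partial>angle_measure) \<le> E r" if "0 < r" "r \<le> s" "s < 1" for r s
    unfolding E_def using f that by (rule integral_dilate_diff_le)
  have sq: "square_integrable angle_measure (?f r)" if "0 < r" "r < 1" for r
    using hardy2D(1)[OF f] that by (rule square_integrable_dilate)
  \<comment> \<open>Radii increasing to 1; the summand 2 makes already the first one,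
    \<open>1/2\<close>, positive.\<close>
  define \<rho> where "\<rho> n = 1 - 1 / (real n + 2)" for n
  have \<rho>: "0 < \<rho> n" "\<rho> n < 1" for n by (auto simp: \<rho>_def field_simps)
  have \<rho>_mono: "\<rho> m \<le> \<rho> n" if "m \<le> n" for m n
    using that by (auto simp: \<rho>_def field_simps)
  have "\<rho> \<longlonglongrightarrow> 1" unfolding \<rho>_def by real_asymp
  then have \<rho>_lim: "filterlim \<rho> (at_left 1) sequentially"
    using \<rho> by (auto simp: filterlim_at intro!: always_eventually less_imp_neq)
  have E\<rho>: "(\<lambda>n. E (\<rho> n)) \<longlonglongrightarrow> 0"
    by (rule filterlim_compose[OF E \<rho>_lim])
  obtain F where F: "square_integrable angle_measure F"
    and lim: "(\<lambda>n. \<integral>\<theta>. (cmod (?f (\<rho> n) \<theta> - F \<theta>))\<^sup>2 \<partial>angle_measure) \<longlonglongrightarrow> 0"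
  proof (rule finite_measure.L2_complete[OF finite_measure_angle, of "\<lambda>n. ?f (\<rho> n)"])
    fix e :: real assume "e > 0"
    then obtain N where N: "\<And>n. n \<ge> N \<Longrightarrow> E (\<rho> n) < e"
      using order_tendstoD(2)[OF E\<rho>] by (auto simp: eventually_sequentially)
    \<comment> \<open>The error is measured at the smaller of the two radii, hence the case
      distinction.\<close>
    have "(\<integral>\<theta>. (cmod (?f (\<rho> i) \<theta> - ?f (\<rho> j) \<theta>))\<^sup>2 \<partial>angle_measure) < e" if "i \<ge> N" "j \<ge> N" for i j
    proof (cases "i \<le> j")
      case True
      then show ?thesis using fE[OF \<rho>(1) \<rho>_mono \<rho>(2), of i j] N[of i] that by simp
    next
      case False
      then show ?thesis
        using fE[OF \<rho>(1) \<rho>_mono \<rho>(2), of j i] N[of j] that by (simp add: norm_minus_commute)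
    qed
    then show "\<exists>N. \<forall>i\<ge>N. \<forall>j\<ge>N. (\<integral>\<theta>. (cmod (?f (\<rho> i) \<theta> - ?f (\<rho> j) \<theta>))\<^sup>2 \<partial>angle_measure) < e"
      by blast
  qed (use sq \<rho> in auto)
  \<comment> \<open>The dilate of radius \<open>\<rho> n\<close> is inserted between that of radius
    \<open>r\<close> and \<open>F\<close>. Once \<open>r < \<rho> n\<close>, the first part costs at
    most \<open>2 * E r\<close>, and the second vanishes as \<open>n\<close> grows.\<close>
  have le: "(\<integral>\<theta>. (cmod (?f r \<theta> - F \<theta>))\<^sup>2 \<partial>angle_measure) \<le> 2 * E r" if r: "0 < r" "r < 1" for r
  proof (rule tendsto_lowerbound)
    let ?I = "\<lambda>n. \<integral>\<theta>. (cmod (?f (\<rho> n) \<theta> - F \<theta>))\<^sup>2 \<partial>angle_measure"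
    show "(\<lambda>n. 2 * E r + 2 * ?I n) \<longlonglongrightarrow> 2 * E r"
      using tendsto_add[OF tendsto_const tendsto_mult_right_zero[OF lim], of "2 * E r" 2] by simp
    have "\<forall>\<^sub>F n in sequentially. r < \<rho> n"
      using order_tendstoD(1)[OF \<open>\<rho> \<longlonglongrightarrow> 1\<close>] r by simp
    then show "\<forall>\<^sub>F n in sequentially.
        (\<integral>\<theta>. (cmod (?f r \<theta> - F \<theta>))\<^sup>2 \<partial>angle_measure) \<le> 2 * E r + 2 * ?I n"
    proof eventually_elim
      case (elim n)
      have i: "integrable angle_measure (\<lambda>\<theta>. (cmod (?f r \<theta> - ?f (\<rho> n) \<theta>))\<^sup>2)"
        "integrable angle_measure (\<lambda>\<theta>. (cmod (?f (\<rho> n) \<theta> - F \<theta>))\<^sup>2)"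
        "integrable angle_measure (\<lambda>\<theta>. (cmod (?f r \<theta> - F \<theta>))\<^sup>2)"
        using square_integrable_diff[OF sq[OF r] sq[OF \<rho>, of n]] square_integrable_diff[OF sq[OF \<rho>, of n] F]
          square_integrable_diff[OF sq[OF r] F] by (auto simp: square_integrable_def)
      have "(\<integral>\<theta>. (cmod (?f r \<theta> - F \<theta>))\<^sup>2 \<partial>angle_measure)
          \<le> (\<integral>\<theta>. 2 * (cmod (?f r \<theta> - ?f (\<rho> n) \<theta>))\<^sup>2 + 2 * (cmod (?f (\<rho> n) \<theta> - F \<theta>))\<^sup>2 \<partial>angle_measure)"
        using i by (intro integral_mono cmod_diff_square_le Bochner_Integration.integrable_add) auto
      also have "\<dots> = 2 * (\<integral>\<theta>. (cmod (?f r \<theta> - ?f (\<rho> n) \<theta>))\<^sup>2 \<partial>angle_measure) + 2 * ?I n"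
        using i by (subst Bochner_Integration.integral_add) auto
      also have "\<dots> \<le> 2 * E r + 2 * ?I n"
        using fE[of r "\<rho> n"] elim r \<rho>[of n] by simp
      finally show ?case .
    qed
  qed simp
  have "((\<lambda>r. \<integral>\<theta>. (cmod (?f r \<theta> - F \<theta>))\<^sup>2 \<partial>angle_measure) \<longlongrightarrow> 0) (at_left 1)"
  proof (rule Lim_null_comparison)
    show "\<forall>\<^sub>F r in at_left 1. norm (\<integral>\<theta>. (cmod (?f r \<theta> - F \<theta>))\<^sup>2 \<partial>angle_measure) \<le> 2 * E r"
      by (rule eventually_at_left_1) (simp add: le)
    show "((\<lambda>r. 2 * E r) \<longlongrightarrow> 0) (at_left 1)"
      by (intro tendsto_mult_right_zero E)
  qed
  with F show thesis
    by (intro that[of F]) (simp add: has_boundary_value_def circle_L2_iff)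
qed

section \<open>The inner product in terms of Taylor coefficients\<close>

lemma has_boundary_value_boundary_value: "f \<in> hardy2 \<Longrightarrow> has_boundary_value f (boundary_value f)"
  unfolding boundary_value_def by (metis has_boundary_value_exists someI)

lemma summable_mult_of_square_summable:
  assumes "summable (\<lambda>n. (cmod (a n))\<^sup>2)" "summable (\<lambda>n. (cmod (b n))\<^sup>2)"
  shows "summable (\<lambda>n. cmod (a n * b n))"
proof (rule summable_comparison_test_ev[OF always_eventually summable_add[OF assms]], rule allI)
  fix n
  show "norm (cmod (a n * b n)) \<le> (cmod (a n))\<^sup>2 + (cmod (b n))\<^sup>2"
    using sum_squares_bound[of "cmod (a n)" "cmod (b n)"]
      mult_nonneg_nonneg[OF norm_ge_zero norm_ge_zero, of "a n" "b n"]
    unfolding norm_mult real_norm_def abs_mult abs_norm_cancel by linarith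
qed

text \<open>Both sides are limits of the same circle integrals \<open>?I r\<close> as
  \<open>r\<close> tends to 1: one by mean square convergence to the boundary values, the other by
  Parseval and Tannery. Limits are unique.\<close>

lemma hardy2_inner_eq:
  assumes f: "f \<in> hardy2" and g: "g \<in> hardy2"
  shows "hardy2_inner f g = (\<Sum>n. taylor_coeff f n * cnj (taylor_coeff g n))"
proof (rule tendsto_unique)
  let ?I = "\<lambda>r. 1 / (2 * of_real pi) * (\<integral>\<theta>. f (of_real r * cis \<theta>) * cnj (g (of_real r * cis \<theta>)) \<partial>angle_measure)"
  note bf = has_boundary_value_boundary_value[OF f] and bg = has_boundary_value_boundary_value[OF g]
  have sq: "\<forall>\<^sub>F r in at_left 1. square_integrable angle_measure (\<lambda>\<theta>. h (of_real r * cis \<theta>))"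
    if "h \<in> hardy2" for h
    by (rule eventually_at_left_1) (intro square_integrable_dilate hardy2D that)
  show "(?I \<longlongrightarrow> hardy2_inner f g) (at_left 1)"
    unfolding hardy2_inner_def
    by (intro tendsto_mult tendsto_const tendsto_integral_mult_cnj sq f g)
       (use bf bg in \<open>auto simp: has_boundary_value_def circle_L2_iff\<close>)
  have "((\<lambda>r. \<Sum>n. taylor_coeff f n * cnj (taylor_coeff g n) * of_real ((r ^ n)\<^sup>2))
      \<longlongrightarrow> (\<Sum>n. taylor_coeff f n * cnj (taylor_coeff g n) * of_real ((1 ^ n)\<^sup>2))) (at_left 1)"
  proof (rule tendsto_suminf_at_left_1)
    show "summable (\<lambda>n. cmod (taylor_coeff f n * cnj (taylor_coeff g n)))"
      by (rule summable_mult_of_square_summable) (simp_all add: hardy2D[OF f] hardy2D[OF g])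
    show "norm (taylor_coeff f n * cnj (taylor_coeff g n) * of_real ((r ^ n)\<^sup>2))
        \<le> cmod (taylor_coeff f n * cnj (taylor_coeff g n))" if "0 < r" "r < 1" for n r
      using that by (subst norm_mult) (auto intro!: mult_left_le power_le_one simp del: of_real_power)
  qed (intro tendsto_intros)
  moreover have "\<forall>\<^sub>F r in at_left 1.
      (\<Sum>n. taylor_coeff f n * cnj (taylor_coeff g n) * of_real ((r ^ n)\<^sup>2)) = ?I r"
    by (rule eventually_at_left_1)
       (rule sums_unique[symmetric, OF Parseval_dilate[OF hardy2D(1)[OF f] hardy2D(1)[OF g]]])
  ultimately show "(?I \<longlongrightarrow> (\<Sum>n. taylor_coeff f n * cnj (taylor_coeff g n))) (at_left 1)"
    by (simp add: tendsto_cong)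
qed simp

lemma hardy2_inner_self:
  assumes "f \<in> hardy2"
  shows "hardy2_inner f f = of_real (\<Sum>n. (cmod (taylor_coeff f n))\<^sup>2)"
  using suminf_of_real[OF hardy2D(3)[OF assms], where 'a = complex]
  by (simp add: hardy2_inner_eq[OF assms assms] complex_norm_square del: of_real_power)

lemma ip_norm_hardy2:
  assumes "f \<in> hardy2"
  shows "(ip_norm hardy2_inner f)\<^sup>2 = (\<Sum>n. (cmod (taylor_coeff f n))\<^sup>2)"
  by (simp add: ip_norm_def hardy2_inner_self[OF assms] suminf_nonneg hardy2D[OF assms])

subsection \<open>Domination and weighted composition\<close>

lemma norm_Parseval_dilate:
  assumes f: "f holomorphic_on unit_disc" and r: "0 < r" "r < 1"
  shows "(\<lambda>n. (cmod (taylor_coeff f n))\<^sup>2 * (r ^ n)\<^sup>2) sums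
    (1 / (2 * pi) * (\<integral>\<theta>. (cmod (f (of_real r * cis \<theta>)))\<^sup>2 \<partial>angle_measure))"
proof -
  have "(\<lambda>n. of_real ((cmod (taylor_coeff f n))\<^sup>2 * (r ^ n)\<^sup>2)) sums
      (of_real (1 / (2 * pi) * (\<integral>\<theta>. (cmod (f (of_real r * cis \<theta>)))\<^sup>2 \<partial>angle_measure)) :: complex)"
    using Parseval_dilate[OF f f r]
    by (simp add: of_real_mult complex_norm_square[symmetric] integral_complex_of_real
        del: of_real_power)
  then show ?thesis
    by (simp only: sums_of_real_iff)
qed

lemma ip_norm_hardy2_nonneg:
  assumes "f \<in> hardy2"
  shows "0 \<le> ip_norm hardy2_inner f"
proof -
  have "hardy2_inner f f = of_real (\<Sum>n. (cmod (taylor_coeff f n))\<^sup>2)"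
    by (rule hardy2_inner_self[OF assms])
  then show ?thesis
    by (simp add: ip_norm_def suminf_nonneg hardy2D[OF assms])
qed

text \<open>The pointwise bound passes to the mean squares on each circle of radius
  \<open>r < 1\<close>. Parseval turns these into sums over coefficients, whose partial sums are
  bounded independently of \<open>r\<close>.\<close>

lemma hardy2_dominated:
  assumes \<psi>: "\<psi> \<in> hardy2" and \<phi>: "\<phi> holomorphic_on unit_disc"
    and zero: "\<And>z. z \<notin> unit_disc \<Longrightarrow> \<phi> z = 0" and C: "C \<ge> 0"
    and dom: "\<And>z. z \<in> unit_disc \<Longrightarrow> cmod (\<phi> z) \<le> C * cmod (\<psi> z)"
  shows "\<phi> \<in> hardy2" "ip_norm hardy2_inner \<phi> \<le> C * ip_norm hardy2_inner \<psi>"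
proof -
  \<comment> \<open>\<open>K\<close> is the square of the norm bound
    \<open>C * ip_norm hardy2_inner \<psi>\<close>.\<close>
  define K where "K = C\<^sup>2 * (\<Sum>n. (cmod (taylor_coeff \<psi> n))\<^sup>2)"
  have int_le: "(\<Sum>n<N. (cmod (taylor_coeff \<phi> n))\<^sup>2 * (r ^ n)\<^sup>2) \<le> K" if r: "0 < r" "r < 1" for r :: real and N
  proof -
    have sq: "square_integrable angle_measure (\<lambda>\<theta>. h (of_real r * cis \<theta>))"
      if "h holomorphic_on unit_disc" for h
      using that r by (rule square_integrable_dilate)
    have S\<phi>: "(\<lambda>n. (cmod (taylor_coeff \<phi> n))\<^sup>2 * (r ^ n)\<^sup>2) sums
        (1 / (2 * pi) * (\<integral>\<theta>. (cmod (\<phi> (of_real r * cis \<theta>)))\<^sup>2 \<partial>angle_measure))"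
      by (intro norm_Parseval_dilate \<phi> r)
    have S\<psi>: "(\<lambda>n. (cmod (taylor_coeff \<psi> n))\<^sup>2 * (r ^ n)\<^sup>2) sums
        (1 / (2 * pi) * (\<integral>\<theta>. (cmod (\<psi> (of_real r * cis \<theta>)))\<^sup>2 \<partial>angle_measure))"
      by (intro norm_Parseval_dilate hardy2D \<psi> r)
    have "(\<Sum>n<N. (cmod (taylor_coeff \<phi> n))\<^sup>2 * (r ^ n)\<^sup>2)
        \<le> 1 / (2 * pi) * (\<integral>\<theta>. (cmod (\<phi> (of_real r * cis \<theta>)))\<^sup>2 \<partial>angle_measure)"
      using sum_le_suminf[OF sums_summable[OF S\<phi>], of "{..<N}"] sums_unique[OF S\<phi>] by simp
    also have "(\<integral>\<theta>. (cmod (\<phi> (of_real r * cis \<theta>)))\<^sup>2 \<partial>angle_measure)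
        \<le> (\<integral>\<theta>. C\<^sup>2 * (cmod (\<psi> (of_real r * cis \<theta>)))\<^sup>2 \<partial>angle_measure)"
    proof (rule integral_mono)
      show "(cmod (\<phi> (of_real r * cis \<theta>)))\<^sup>2 \<le> C\<^sup>2 * (cmod (\<psi> (of_real r * cis \<theta>)))\<^sup>2" for \<theta>
        using dom[of "of_real r * cis \<theta>"] r by (simp add: norm_mult power_mono flip: power_mult_distrib)
    qed (use sq[OF \<phi>] sq[OF hardy2D(1)[OF \<psi>]] in \<open>auto simp: square_integrable_def\<close>)
    also have "1 / (2 * pi) * (\<integral>\<theta>. C\<^sup>2 * (cmod (\<psi> (of_real r * cis \<theta>)))\<^sup>2 \<partial>angle_measure)
        = C\<^sup>2 * (\<Sum>n. (cmod (taylor_coeff \<psi> n))\<^sup>2 * (r ^ n)\<^sup>2)"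
      by (simp flip: sums_unique[OF S\<psi>])
    also have "(\<Sum>n. (cmod (taylor_coeff \<psi> n))\<^sup>2 * (r ^ n)\<^sup>2) \<le> (\<Sum>n. (cmod (taylor_coeff \<psi> n))\<^sup>2)"
      using r by (intro suminf_le sums_summable[OF S\<psi>] hardy2D \<psi>)
        (auto intro!: mult_left_le power_le_one)
    finally show ?thesis by (simp add: K_def mult_left_mono divide_right_mono)
  qed
  \<comment> \<open>The limit in \<open>r\<close> is taken for finite sums only: summability of the
    coefficients of \<open>\<phi>\<close> is what this bound is meant to prove.\<close>
  have le: "(\<Sum>n<N. (cmod (taylor_coeff \<phi> n))\<^sup>2) \<le> K" for N
  proof (rule tendsto_upperbound)
    have "((\<lambda>r. \<Sum>n<N. (cmod (taylor_coeff \<phi> n))\<^sup>2 * (r ^ n)\<^sup>2)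
        \<longlongrightarrow> (\<Sum>n<N. (cmod (taylor_coeff \<phi> n))\<^sup>2 * (1 ^ n)\<^sup>2)) (at_left 1)"
      by (intro tendsto_intros)
    then show "((\<lambda>r. \<Sum>n<N. (cmod (taylor_coeff \<phi> n))\<^sup>2 * (r ^ n)\<^sup>2)
        \<longlongrightarrow> (\<Sum>n<N. (cmod (taylor_coeff \<phi> n))\<^sup>2)) (at_left 1)" by simp
    show "\<forall>\<^sub>F r in at_left 1. (\<Sum>n<N. (cmod (taylor_coeff \<phi> n))\<^sup>2 * (r ^ n)\<^sup>2) \<le> K"
      by (rule eventually_at_left_1) (rule int_le)
  qed simp
  have summ: "summable (\<lambda>n. (cmod (taylor_coeff \<phi> n))\<^sup>2)"
    using le by (intro summableI_nonneg_bounded) auto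
  with \<phi> zero show h: "\<phi> \<in> hardy2"
    by (simp add: hardy2_def taylor_coeff_def)
  have "(ip_norm hardy2_inner \<phi>)\<^sup>2 \<le> (C * ip_norm hardy2_inner \<psi>)\<^sup>2"
    using suminf_le_const[OF summ le] by (simp add: ip_norm_hardy2 h \<psi> K_def power_mult_distrib)
  moreover have "0 \<le> C * ip_norm hardy2_inner \<psi>"
    by (intro mult_nonneg_nonneg C ip_norm_hardy2_nonneg \<psi>)
  ultimately show "ip_norm hardy2_inner \<phi> \<le> C * ip_norm hardy2_inner \<psi>"
    by (rule power2_le_imp_le)
qed

section \<open>Pointwise bounds inside the disc\<close>

lemma cmod_taylor_coeff_le:
  assumes f: "f \<in> hardy2"
  shows "cmod (taylor_coeff f n) \<le> ip_norm hardy2_inner f"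
proof (rule power2_le_imp_le)
  show "(cmod (taylor_coeff f n))\<^sup>2 \<le> (ip_norm hardy2_inner f)\<^sup>2"
    using sum_le_suminf[OF hardy2D(3)[OF f], of "{n}"] by (simp add: ip_norm_hardy2[OF f])
qed (rule ip_norm_hardy2_nonneg[OF f])

text \<open>Every Taylor coefficient is at most the norm, so the series is dominated by a geometric
  one; its sum gives the factor \<open>1 / (1 - \<rho>)\<close>.\<close>

lemma cmod_hardy2_le:
  assumes f: "f \<in> hardy2" and z: "cmod z \<le> \<rho>" and \<rho>: "\<rho> < 1"
  shows "cmod (f z) \<le> ip_norm hardy2_inner f / (1 - \<rho>)"
proof -
  have "0 \<le> \<rho>" using z norm_ge_zero[of z] by linarith
  have zd: "z \<in> unit_disc" using z \<rho> by simp
  have summ: "summable (\<lambda>n. cmod (taylor_coeff f n * z ^ n))"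
    using hardy2D(1)[OF f] zd by (rule summable_norm_taylor_series)
  have geo: "(\<lambda>n. ip_norm hardy2_inner f * \<rho> ^ n) sums (ip_norm hardy2_inner f * (1 / (1 - \<rho>)))"
    using \<open>0 \<le> \<rho>\<close> \<rho> by (intro sums_mult geometric_sums) simp
  have "cmod (f z) = cmod (\<Sum>n. taylor_coeff f n * z ^ n)"
    using taylor_series_sums[OF hardy2D(1)[OF f] zd] by (simp add: sums_iff)
  also have "\<dots> \<le> (\<Sum>n. cmod (taylor_coeff f n * z ^ n))"
    by (rule summable_norm[OF summ])
  also have "\<dots> \<le> (\<Sum>n. ip_norm hardy2_inner f * \<rho> ^ n)"
    using summ sums_summable[OF geo] z
    by (intro suminf_le)
       (auto simp: norm_mult norm_power intro!: mult_mono power_mono cmod_taylor_coeff_le f ip_norm_hardy2_nonneg)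
  also have "\<dots> = ip_norm hardy2_inner f / (1 - \<rho>)"
    using sums_unique[OF geo] by simp
  finally show ?thesis .
qed

section \<open>The monomials, cut off outside the disc, as an orthonormal basis\<close>

definition disc_monomial :: "nat \<Rightarrow> complex \<Rightarrow> complex" where
  "disc_monomial n z = (if z \<in> unit_disc then z ^ n else 0)"

lemma holomorphic_disc_monomial: "disc_monomial n holomorphic_on unit_disc"
  by (rule holomorphic_transform[of "\<lambda>z. z ^ n"]) (auto intro!: holomorphic_intros simp: disc_monomial_def)

lemma taylor_coeff_disc_monomial: "taylor_coeff (disc_monomial m) n = (if n = m then 1 else 0)"
proof -
  have "(deriv ^^ n) (disc_monomial m) 0 = (deriv ^^ n) (\<lambda>w. (w - 0) ^ m) 0"
    by (rule higher_deriv_transform_within_open[OF holomorphic_disc_monomial _ open_ball])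
       (auto intro!: holomorphic_intros simp: disc_monomial_def)
  also have "\<dots> = pochhammer (of_nat (Suc m - n)) n * 0 ^ (m - n)"
    by (subst higher_deriv_power) simp
  \<comment> \<open>For \<open>n < m\<close> the power of 0 vanishes. For \<open>n > m\<close> the
    truncated \<open>Suc m - n\<close> is 0 and the Pochhammer factor vanishes. For
    \<open>n = m\<close> what remains is \<open>pochhammer 1 n\<close> times
    \<open>0 ^ 0 = 1\<close>.\<close>
  also have "\<dots> = (if n = m then fact n else 0)"
    by (auto simp: pochhammer_0_left pochhammer_fact)
  finally show ?thesis by (simp add: taylor_coeff_def)
qed

lemma disc_monomial_hardy2: "disc_monomial n \<in> hardy2"
proof -
  have "summable (\<lambda>k. (cmod (taylor_coeff (disc_monomial n) k))\<^sup>2)"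
    by (rule summable_finite[of "{n}"]) (auto simp: taylor_coeff_disc_monomial)
  then show ?thesis
    using holomorphic_disc_monomial[of n] by (auto simp: hardy2_def disc_monomial_def taylor_coeff_def)
qed

lemma hardy2_inner_disc_monomial:
  assumes "f \<in> hardy2"
  shows "hardy2_inner f (disc_monomial n) = taylor_coeff f n"
proof -
  have "(\<Sum>k. taylor_coeff f k * cnj (taylor_coeff (disc_monomial n) k))
      = (\<Sum>k\<in>{n}. taylor_coeff f k * cnj (taylor_coeff (disc_monomial n) k))"
    by (rule suminf_finite) (auto simp: taylor_coeff_disc_monomial)
  then show ?thesis
    using assms by (simp add: hardy2_inner_eq disc_monomial_hardy2 taylor_coeff_disc_monomial)
qed

text \<open>Allows a sum over the set of basis vectors to be reindexed as a series over the
  exponents.\<close>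

lemma inj_disc_monomial: "inj disc_monomial"
proof (rule injI)
  fix m n assume "disc_monomial m = disc_monomial n"
  then have "taylor_coeff (disc_monomial m) m = taylor_coeff (disc_monomial n) m" by simp
  then show "m = n" by (simp add: taylor_coeff_disc_monomial split: if_splits)
qed

text \<open>Inner products with the monomials read off Taylor coefficients; a function orthogonal to
  all of them has a zero Taylor series on the disc, and off the disc it vanishes by the
  representation.\<close>

lemma orthonormal_basis_disc_monomial:
  "orthonormal_basis_on hardy2 hardy2_inner (range disc_monomial)"
  unfolding orthonormal_basis_on_def
proof (intro conjI ballI impI)
  fix e e' assume "e \<in> range disc_monomial" "e' \<in> range disc_monomial"
  then show "hardy2_inner e e' = (if e = e' then 1 else 0)"
    using inj_disc_monomial
    by (auto simp: hardy2_inner_disc_monomial disc_monomial_hardy2 taylor_coeff_disc_monomial inj_eq)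
next
  fix f assume f: "f \<in> hardy2" and "\<forall>e\<in>range disc_monomial. hardy2_inner f e = 0"
  then have coeff: "taylor_coeff f n = 0" for n
    by (auto simp: hardy2_inner_disc_monomial)
  have "f z = 0" if "z \<in> unit_disc" for z
    using taylor_series_sums[OF hardy2D(1)[OF f] that] coeff by (simp add: sums_iff)
  then show "f = (\<lambda>_. 0)" using hardy2D(2)[OF f] by blast
qed (auto simp: disc_monomial_hardy2)

section \<open>The Hilbert-Schmidt property of the weighted composition operator\<close>

lemma compact_subset_unit_disc:
  assumes "compact K" "K \<subseteq> unit_disc"
  shows "\<exists>\<rho>\<ge>0. \<rho> < 1 \<and> (\<forall>z\<in>K. cmod z \<le> \<rho>)"
proof (cases "K = {}")
  case False
  then obtain x where x: "x \<in> K" "\<And>z. z \<in> K \<Longrightarrow> cmod z \<le> cmod x"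
    using continuous_attains_sup[OF assms(1), of cmod] continuous_on_norm_id by blast
  with assms(2) show ?thesis by (intro exI[of _ "cmod x"]) auto
qed (auto intro: exI[of _ 0])

theorem proposition2p3:
  fixes \<psi> \<tau> :: "complex \<Rightarrow> complex"
  assumes "\<tau> holomorphic_on unit_disc"
    and "\<tau> ` unit_disc \<subseteq> unit_disc"
    and "closure (\<tau> ` unit_disc) \<subseteq> unit_disc"
    and "\<psi> \<in> hardy2"
  shows "hilbert_schmidt_on hardy2 hardy2_inner (weighted_comp \<psi> \<tau>)"
proof -
  let ?W = "weighted_comp \<psi> \<tau>" and ?N = "ip_norm hardy2_inner"
  have "compact (closure (\<tau> ` unit_disc))"
    using bounded_subset[OF bounded_ball assms(2)] by (simp add: compact_closure)
  \<comment> \<open>Here the closure matters: the image alone could approach the circle, whereas a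
    compact subset of the open disc stays within some radius below 1.\<close>
  then obtain \<rho> where \<rho>: "0 \<le> \<rho>" "\<rho> < 1" and bound: "\<And>z. z \<in> closure (\<tau> ` unit_disc) \<Longrightarrow> cmod z \<le> \<rho>"
    using compact_subset_unit_disc[OF _ assms(3)] by blast
  have \<tau>: "cmod (\<tau> z) \<le> \<rho>" if "z \<in> unit_disc" for z
    using subsetD[OF closure_subset imageI[OF that]] by (rule bound)
  have hol: "?W f holomorphic_on unit_disc" if "f \<in> hardy2" for f
  proof (rule holomorphic_transform)
    have "(f \<circ> \<tau>) holomorphic_on unit_disc"
      by (rule holomorphic_on_compose_gen[OF assms(1) hardy2D(1)[OF that] assms(2)])
    then show "(\<lambda>z. \<psi> z * (f \<circ> \<tau>) z) holomorphic_on unit_disc"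
      by (intro holomorphic_on_mult hardy2D(1)[OF assms(4)])
  qed (simp add: weighted_comp_def)
  \<comment> \<open>One estimate serves twice: with \<open>C = ?N f / (1 - \<rho>)\<close> it gives
    boundedness, with \<open>C = \<rho> ^ n\<close> the decay on the basis.\<close>
  have W: "?W f \<in> hardy2" "?N (?W f) \<le> C * ?N \<psi>"
    if f: "f \<in> hardy2" and C: "C \<ge> 0" "\<And>z. z \<in> unit_disc \<Longrightarrow> cmod (f (\<tau> z)) \<le> C" for f C
  proof -
    have zero: "?W f z = 0" if "z \<notin> unit_disc" for z
      using that by (simp add: weighted_comp_def)
    have dom: "cmod (?W f z) \<le> C * cmod (\<psi> z)" if "z \<in> unit_disc" for z
      using mult_left_mono[OF C(2)[OF that], of "cmod (\<psi> z)"] that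
      by (simp add: weighted_comp_def norm_mult mult.commute)
    show "?W f \<in> hardy2" "?N (?W f) \<le> C * ?N \<psi>"
      using hardy2_dominated[OF assms(4) hol[OF f] zero C(1) dom] by blast+
  qed
  have Wf: "?W f \<in> hardy2" "?N (?W f) \<le> (?N \<psi> / (1 - \<rho>)) * ?N f" if f: "f \<in> hardy2" for f
  proof -
    have C: "0 \<le> ?N f / (1 - \<rho>)"
      using \<rho>(2) ip_norm_hardy2_nonneg[OF f] by simp
    note f_le = cmod_hardy2_le[OF f \<tau> \<rho>(2)]
    show "?W f \<in> hardy2" by (rule W[OF f C f_le])
    show "?N (?W f) \<le> (?N \<psi> / (1 - \<rho>)) * ?N f"
      using W(2)[OF f C f_le] by (simp add: mult.commute)
  qed
  have "bounded_operator_on hardy2 hardy2_inner ?W"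
    unfolding bounded_operator_on_def
  proof (intro conjI ballI allI)
    show "\<exists>C. \<forall>f\<in>hardy2. ?N (?W f) \<le> C * ?N f"
      using Wf(2) by blast
    show "?W f \<in> hardy2" if "f \<in> hardy2" for f
      using that by (rule Wf(1))
  qed (auto simp: weighted_comp_def fun_eq_iff distrib_left)
  moreover have "(\<lambda>e. (?N (?W e))\<^sup>2) summable_on range disc_monomial"
    unfolding summable_on_reindex[OF inj_disc_monomial] o_def
  proof (rule summable_nonneg_imp_summable_on)
    have le: "(?N (?W (disc_monomial n)))\<^sup>2 \<le> (?N \<psi>)\<^sup>2 * (\<rho>\<^sup>2) ^ n" for n
    proof -
      \<comment> \<open>The operator bound would give the same constant for every unit vector, which
        is not summable; the size of the monomial on \<open>|z| \<le> \<rho>\<close> gives geometric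
        decay.\<close>
      have "cmod (disc_monomial n (\<tau> z)) \<le> \<rho> ^ n" if "z \<in> unit_disc" for z
        using power_mono[OF \<tau>[OF that], of n] \<rho>(1) by (simp add: disc_monomial_def norm_power)
      then have "?N (?W (disc_monomial n)) \<le> \<rho> ^ n * ?N \<psi>"
        by (rule W(2)[OF disc_monomial_hardy2 zero_le_power[OF \<rho>(1)]])
      then have "(?N (?W (disc_monomial n)))\<^sup>2 \<le> (\<rho> ^ n * ?N \<psi>)\<^sup>2"
        by (intro power_mono ip_norm_hardy2_nonneg Wf disc_monomial_hardy2)
      then show ?thesis by (simp add: power_mult_distrib power2_eq_square mult_ac)
    qed
    have "summable (\<lambda>n. (?N \<psi>)\<^sup>2 * (\<rho>\<^sup>2) ^ n)"
      using \<rho> by (intro summable_mult summable_geometric) (simp add: abs_square_less_1)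
    then show "summable (\<lambda>n. (?N (?W (disc_monomial n)))\<^sup>2)"
      by (rule summable_comparison_test_ev[rotated]) (simp add: le)
  qed simp
  ultimately show ?thesis
    unfolding hilbert_schmidt_on_def
    by (intro conjI exI[of _ "range disc_monomial"] orthonormal_basis_disc_monomial)
qed

end
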